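(* Let $\bm F$ be a locally Lipschitz vector field on the $N$-torus that generates a complete flow, let $\Phi_s(\bm\theta_0)$ denote the flow of $\frac{\mathrm d\bm\vartheta}{\mathrm ds}=\bm F(\bm\vartheta)$, $\bm\vartheta(0)=\bm\theta_0$, and let $K:[0,\infty)\to\mathbb R$ be locally integrable with $K\ge 0$ and $$S_\infty:=\int_0^\infty K(t)\,\mathrm dt<\infty .$$ Then the solution of $\dot{\bm\theta}(t)=K(t)\bm F(\bm\theta(t))$, $\bm\theta(0)=\bm\theta_0$, satisfies $$\lim_{t\to\infty}\bm\theta(t)=\Phi_{S_\infty}(\bm\theta_0).$$
   Context: Since $K$ is only locally integrable, a solution means a locally absolutely continuous function satisfying the differential equation for almost every $t$. A vector field on the $N$-torus may be viewed as a vector field on $\mathbb R^N$ that is $2\pi$-periodic in each coordinate. The motivating example is the Kuramoto field $F_i(\bm\theta)=\sum_jA_{ij}\sin(\theta_j-\theta_i)$ with $A$ the symmetric nonnegative adjacency matrix of a fixed connected weighted graph, $A_{ii}=0$. *)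

theory Defs
  imports "HOL-Analysis.Analysis"
begin

text \<open>A vector field on the \<open>N\<close>-torus is represented by its lift to \<open>\<real>\<^sup>N\<close>.\<close>

definition torus_vector_field :: "(real ^ 'n \<Rightarrow> real ^ 'n) \<Rightarrow> bool" where
  "torus_vector_field F \<longleftrightarrow> (\<forall>x i. F (x + axis i (2 * pi)) = F x)"

text \<open>The library predicate \<open>local_lipschitz\<close> is for time-dependent families; here the
  family is constant in time.\<close>

definition locally_lipschitz_field :: "('a::metric_space \<Rightarrow> 'a) \<Rightarrow> bool" where
  "locally_lipschitz_field F \<longleftrightarrow> local_lipschitz (UNIV :: real set) UNIV (\<lambda>_. F)"

definition complete_flow_of ::
  "('a::real_normed_vector \<Rightarrow> 'a) \<Rightarrow> (real \<Rightarrow> 'a \<Rightarrow> 'a) \<Rightarrow> bool" where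
  "complete_flow_of F \<Phi> \<longleftrightarrow>
     (\<forall>x. \<Phi> 0 x = x \<and>
          (\<forall>s. ((\<lambda>r. \<Phi> r x) has_vector_derivative F (\<Phi> s x)) (at s)))"

text \<open>Absolute continuity of functions on a compact interval; not to be confused with the
  library's \<open>absolutely_continuous\<close>, a relation between measures. A pair \<open>(u, v)\<close>
  stands for the interval with endpoints \<open>u\<close> and \<open>v\<close>.\<close>

definition abs_cont_on_interval :: "real \<Rightarrow> real \<Rightarrow> (real \<Rightarrow> 'a::metric_space) \<Rightarrow> bool" where
  "abs_cont_on_interval a b f \<longleftrightarrow>
     (\<forall>\<epsilon>>0. \<exists>\<delta>>0. \<forall>D :: (real \<times> real) set.
        finite D \<longrightarrow>
        (\<forall>(u, v)\<in>D. a \<le> u \<and> u \<le> v \<and> v \<le> b) \<longrightarrow>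
        pairwise (\<lambda>(u, v) (u', v'). disjnt {u<..<v} {u'<..<v'}) D \<longrightarrow>
        (\<Sum>(u, v)\<in>D. v - u) < \<delta> \<longrightarrow>
        (\<Sum>(u, v)\<in>D. dist (f u) (f v)) < \<epsilon>)"

definition locally_abs_cont_on :: "real set \<Rightarrow> (real \<Rightarrow> 'a::metric_space) \<Rightarrow> bool" where
  "locally_abs_cont_on S f \<longleftrightarrow> (\<forall>a b. {a..b} \<subseteq> S \<longrightarrow> abs_cont_on_interval a b f)"

definition locally_integrable_halfline :: "(real \<Rightarrow> real) \<Rightarrow> bool" where
  "locally_integrable_halfline K \<longleftrightarrow> (\<forall>T\<ge>0. set_integrable lebesgue {0..T} K)"

text \<open>For a nonnegative \<open>K\<close>, its integral over \<open>[0, \<infinity>)\<close> as an extended real number.\<close>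

definition total_integral :: "(real \<Rightarrow> real) \<Rightarrow> ennreal" where
  "total_integral K = (\<integral>\<^sup>+ t \<in> {0..}. ennreal (K t) \<partial>lebesgue)"

text \<open>Solutions on \<open>[0, \<infinity>)\<close> in the sense of Caratheodory; values of \<open>\<theta>\<close> at
  negative times are irrelevant.\<close>

definition caratheodory_solution ::
  "(real \<Rightarrow> real) \<Rightarrow> ('a::real_normed_vector \<Rightarrow> 'a) \<Rightarrow> 'a \<Rightarrow> (real \<Rightarrow> 'a) \<Rightarrow> bool" where
  "caratheodory_solution K F \<theta>\<^sub>0 \<theta> \<longleftrightarrow>
     locally_abs_cont_on {0..} \<theta> \<and>
     \<theta> 0 = \<theta>\<^sub>0 \<and>
     (AE t in lebesgue. t \<ge> 0 \<longrightarrow>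
        (\<theta> has_vector_derivative K t *\<^sub>R F (\<theta> t)) (at t within {0..}))"

end

theory Submission
  imports Defs
begin

text \<open>With \<open>S t = \<integral>\<^sub>0\<^sup>t K\<close>, the solution is the time change \<open>\<theta> t = \<Phi> (S t) \<theta>\<^sub>0\<close>: it solves the
  equation because \<open>S' = K\<close> almost everywhere (Lebesgue's differentiation theorem, obtained from
  Henstock's lemma and a Vitali covering), and it is the only solution by a Gronwall argument, which
  needs the fundamental theorem of calculus for absolutely continuous functions. The limit is then
  the continuity of the flow at \<open>S\<^sub>\<infinity> = lim S\<close>.\<close>

lemma sum_integral_disjoint_intervals_le:
  fixes D :: "(real \<times> real) set" and h :: "real \<Rightarrow> real"
  assumes "finite D" "pairwise (\<lambda>(u, v) (u', v'). disjnt {u<..<v} {u'<..<v'}) D"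
    and h: "set_integrable lebesgue T h" "\<And>x. x \<in> T \<Longrightarrow> 0 \<le> h x"
    and sub: "\<And>u v. (u, v) \<in> D \<Longrightarrow> {u<..<v} \<subseteq> T"
  shows "(\<Sum>(u, v)\<in>D. LINT x:{u<..<v}|lebesgue. h x) \<le> (LINT x:T|lebesgue. h x)"
proof -
  let ?U = "\<Union>(u, v)\<in>D. {u<..<v}"
  have "disjoint_family_on (\<lambda>(u, v). {u<..<v}) D"
    using assms(2) by (fastforce simp: disjoint_family_on_def pairwise_def disjnt_def)
  moreover have "set_integrable lebesgue {u<..<v} h" if "(u, v) \<in> D" for u v
    by (rule set_integrable_subset[OF h(1)]) (use sub that in auto)
  ultimately have "(LINT x:?U|lebesgue. h x) = (\<Sum>d\<in>D. LINT x:(case d of (u, v) \<Rightarrow> {u<..<v})|lebesgue. h x)"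
    using assms(1) by (intro set_integral_finite_Union) auto
  also have "\<dots> = (\<Sum>(u, v)\<in>D. LINT x:{u<..<v}|lebesgue. h x)"
    by (simp add: split_def)
  finally have sum_eq: "(LINT x:?U|lebesgue. h x) = (\<Sum>(u, v)\<in>D. LINT x:{u<..<v}|lebesgue. h x)" .
  have int_U: "set_integrable lebesgue ?U h"
    by (rule set_integrable_subset[OF h(1)]) (use sub assms(1) in auto)
  have "(LINT x:?U|lebesgue. h x) \<le> (LINT x:T|lebesgue. h x)"
    unfolding set_lebesgue_integral_def
  proof (rule integral_mono)
    show "integrable lebesgue (\<lambda>x. indicat_real ?U x *\<^sub>R h x)"
      using int_U by (simp add: set_integrable_def)
    show "integrable lebesgue (\<lambda>x. indicat_real T x *\<^sub>R h x)"
      using h(1) by (simp add: set_integrable_def)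
    show "indicat_real ?U x *\<^sub>R h x \<le> indicat_real T x *\<^sub>R h x" for x
      using h(2)[of x] sub by (cases "x \<in> ?U") (auto simp: indicator_def)
  qed
  then show ?thesis
    unfolding sum_eq .
qed

lemma sum_length_disjoint_intervals_le:
  fixes D :: "(real \<times> real) set"
  assumes D: "finite D" "pairwise (\<lambda>(u, v) (u', v'). disjnt {u<..<v} {u'<..<v'}) D"
    and T: "T \<in> lmeasurable" and sub: "\<And>u v. (u, v) \<in> D \<Longrightarrow> u \<le> v \<and> {u<..<v} \<subseteq> T"
  shows "(\<Sum>(u, v)\<in>D. v - u) \<le> measure lebesgue T"
proof -
  have "(\<Sum>(u, v)\<in>D. LINT x:{u<..<v}|lebesgue. (1::real)) \<le> (LINT x:T|lebesgue. 1)"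
    using D T sub
    by (intro sum_integral_disjoint_intervals_le) (auto simp: set_integrable_def fmeasurable_def)
  also have "(\<Sum>(u, v)\<in>D. LINT x:{u<..<v}|lebesgue. (1::real)) = (\<Sum>(u, v)\<in>D. v - u)"
    using sub by (intro sum.cong) (auto simp: set_lebesgue_integral_def)
  finally show ?thesis
    by (simp add: set_lebesgue_integral_def)
qed

text \<open>Truncating \<open>k\<close> at a large level \<open>n\<close> leaves a remainder with small integral, while the
  truncated part contributes at most \<open>n\<close> times the total length of the intervals.\<close>

lemma abs_cont_on_interval_if_dist_le_integral:
  fixes f :: "real \<Rightarrow> 'a::metric_space" and k :: "real \<Rightarrow> real"
  assumes k: "set_integrable lebesgue {a..b} k" "\<And>x. x \<in> {a..b} \<Longrightarrow> 0 \<le> k x"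
    and le: "\<And>u v. \<lbrakk>a \<le> u; u \<le> v; v \<le> b\<rbrakk> \<Longrightarrow> dist (f u) (f v) \<le> integral {u..v} k"
  shows "abs_cont_on_interval a b f"
  unfolding abs_cont_on_interval_def
proof (intro allI impI)
  fix \<epsilon> :: real assume "\<epsilon> > 0"
  define g where "g n x = min (k x) (real n)" for n x
  have meas: "(\<lambda>x. indicat_real {a..b} x *\<^sub>R k x) \<in> borel_measurable lebesgue"
    using k(1) by (simp add: set_integrable_def)
  have g_eq: "indicat_real {a..b} x *\<^sub>R g n x = min (indicat_real {a..b} x *\<^sub>R k x) (real n)" for n x
    by (auto simp: g_def indicator_def)
  have meas_g: "(\<lambda>x. indicat_real {a..b} x *\<^sub>R g n x) \<in> borel_measurable lebesgue" for n
    unfolding g_eq using meas by measurable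
  have ki: "integrable lebesgue (\<lambda>x. indicat_real {a..b} x *\<^sub>R k x)"
    using k(1) by (simp add: set_integrable_def)
  have gb: "norm (indicat_real {a..b} x *\<^sub>R g n x) \<le> indicat_real {a..b} x *\<^sub>R k x" for n x
    using k(2)[of x] by (auto simp: g_def indicator_def)
  have int_g: "set_integrable lebesgue {a..b} (g n)" for n
    unfolding set_integrable_def
    by (rule Bochner_Integration.integrable_bound[OF ki meas_g]) (intro AE_I2 order_trans[OF gb], simp)
  have "(\<lambda>n. LINT x:{a..b}|lebesgue. g n x) \<longlonglongrightarrow> (LINT x:{a..b}|lebesgue. k x)"
    unfolding set_lebesgue_integral_def
  proof (rule integral_dominated_convergence[OF meas meas_g ki])
    show "AE x in lebesgue. (\<lambda>n. indicat_real {a..b} x *\<^sub>R g n x) \<longlonglongrightarrow> indicat_real {a..b} x *\<^sub>R k x"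
    proof (intro AE_I2 tendsto_intros tendsto_eventually)
      fix x
      obtain N where "k x \<le> real N" using real_arch_simple by blast
      then show "\<forall>\<^sub>F n in sequentially. g n x = k x"
        by (intro eventually_sequentiallyI[of N]) (simp add: g_def)
    qed
  qed (use gb in auto)
  then obtain n where n: "\<bar>(LINT x:{a..b}|lebesgue. g n x) - (LINT x:{a..b}|lebesgue. k x)\<bar> < \<epsilon> / 2"
    using \<open>\<epsilon> > 0\<close> by (metis LIMSEQ_D half_gt_zero order_refl real_norm_def)
  define h where "h x = k x - g n x" for x
  have int_h: "set_integrable lebesgue {a..b} h"
    unfolding h_def using k(1) int_g by (rule set_integral_diff)
  have h0: "0 \<le> h x" for x by (simp add: h_def g_def)
  have small: "(LINT x:{a..b}|lebesgue. h x) < \<epsilon> / 2"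
    using n set_integral_diff(2)[OF k(1) int_g[of n]] unfolding h_def by linarith
  define \<delta> where "\<delta> = \<epsilon> / (2 * (real n + 1))"
  show "\<exists>\<delta>>0. \<forall>D. finite D \<longrightarrow> (\<forall>(u, v)\<in>D. a \<le> u \<and> u \<le> v \<and> v \<le> b) \<longrightarrow>
      pairwise (\<lambda>(u, v) (u', v'). disjnt {u<..<v} {u'<..<v'}) D \<longrightarrow>
      (\<Sum>(u, v)\<in>D. v - u) < \<delta> \<longrightarrow> (\<Sum>(u, v)\<in>D. dist (f u) (f v)) < \<epsilon>"
  proof (intro exI[of _ \<delta>] conjI allI impI)
    show "\<delta> > 0" using \<open>\<epsilon> > 0\<close> by (simp add: \<delta>_def)
    fix D :: "(real \<times> real) set"
    assume D: "finite D" "\<forall>(u, v)\<in>D. a \<le> u \<and> u \<le> v \<and> v \<le> b"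
      "pairwise (\<lambda>(u, v) (u', v'). disjnt {u<..<v} {u'<..<v'}) D" "(\<Sum>(u, v)\<in>D. v - u) < \<delta>"
    have "dist (f u) (f v) \<le> real n * (v - u) + (LINT x:{u<..<v}|lebesgue. h x)"
      if "(u, v) \<in> D" for u v
    proof -
      have uv: "a \<le> u" "u \<le> v" "v \<le> b" using that D(2) by auto
      have ih: "set_integrable lebesgue {u..v} h" and ig: "set_integrable lebesgue {u..v} (g n)"
        using uv by (auto intro: set_integrable_subset[OF int_h] set_integrable_subset[OF int_g])
      then have HK: "h integrable_on {u..v}" "g n integrable_on {u..v}"
        by (simp_all add: set_lebesgue_integral_eq_integral(1))
      have "integral {u..v} k = integral {u..v} (g n) + integral {u..v} h"
        using HK by (subst Henstock_Kurzweil_Integration.integral_add[symmetric]) (simp_all add: h_def)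
      moreover have "integral {u..v} (g n) \<le> integral {u..v} (\<lambda>_. real n)"
        using HK by (intro integral_le) (auto simp: g_def)
      moreover have "integral {u..v} h = (LINT x:{u<..<v}|lebesgue. h x)"
      proof -
        have "set_integrable lebesgue {u<..<v} h"
          by (rule set_integrable_subset[OF ih]) auto
        then show ?thesis
          by (simp add: set_lebesgue_integral_eq_integral(2) integral_open_interval_real)
      qed
      ultimately show ?thesis using le[OF uv] uv by (simp add: mult.commute)
    qed
    then have "(\<Sum>(u, v)\<in>D. dist (f u) (f v))
        \<le> (\<Sum>(u, v)\<in>D. real n * (v - u) + (LINT x:{u<..<v}|lebesgue. h x))"
      by (intro sum_mono) auto
    also have "\<dots> = real n * (\<Sum>(u, v)\<in>D. v - u) + (\<Sum>(u, v)\<in>D. LINT x:{u<..<v}|lebesgue. h x)"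
      by (simp add: split_def sum.distrib sum_distrib_left)
    also have "\<dots> < \<epsilon> / 2 + \<epsilon> / 2"
    proof (rule add_le_less_mono)
      have "real n * (\<Sum>(u, v)\<in>D. v - u) \<le> real n * \<delta>"
        using D(4) by (intro mult_left_mono) auto
      also have "\<dots> \<le> \<epsilon> / 2"
        using \<open>\<epsilon> > 0\<close> by (simp add: \<delta>_def divide_simps)
      finally show "real n * (\<Sum>(u, v)\<in>D. v - u) \<le> \<epsilon> / 2" .
      have "(\<Sum>(u, v)\<in>D. LINT x:{u<..<v}|lebesgue. h x) \<le> (LINT x:{a..b}|lebesgue. h x)"
        by (rule sum_integral_disjoint_intervals_le[OF D(1,3) int_h]) (use D(2) h0 in force)+
      then show "(\<Sum>(u, v)\<in>D. LINT x:{u<..<v}|lebesgue. h x) < \<epsilon> / 2" using small by linarith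
    qed
    finally show "(\<Sum>(u, v)\<in>D. dist (f u) (f v)) < \<epsilon>" by simp
  qed
qed

lemma abs_cont_on_interval_imp_continuous_on:
  assumes "abs_cont_on_interval a b f"
  shows "continuous_on {a..b} f"
  unfolding continuous_on_iff
proof (intro ballI allI impI)
  fix x and e :: real assume x: "x \<in> {a..b}" and "e > 0"
  then obtain \<delta> where "\<delta> > 0" and \<delta>: "\<And>D :: (real \<times> real) set.
        \<lbrakk>finite D; \<forall>(u, v)\<in>D. a \<le> u \<and> u \<le> v \<and> v \<le> b;
        pairwise (\<lambda>(u, v) (u', v'). disjnt {u<..<v} {u'<..<v'}) D; (\<Sum>(u, v)\<in>D. v - u) < \<delta>\<rbrakk> \<Longrightarrow>
        (\<Sum>(u, v)\<in>D. dist (f u) (f v)) < e"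
    using assms unfolding abs_cont_on_interval_def by meson
  have "dist (f y) (f x) < e" if "y \<in> {a..b}" "dist y x < \<delta>" for y
  proof (cases "x \<le> y")
    case True
    then show ?thesis using \<delta>[of "{(x, y)}"] x that by (simp add: dist_real_def dist_commute)
  next
    case False
    then show ?thesis using \<delta>[of "{(y, x)}"] x that by (simp add: dist_real_def)
  qed
  then show "\<exists>d>0. \<forall>x'\<in>{a..b}. dist x' x < d \<longrightarrow> dist (f x') (f x) < e"
    using \<open>\<delta> > 0\<close> by blast
qed

lemma abs_cont_on_interval_if_dist_le_add:
  assumes f: "abs_cont_on_interval a b f" and g: "abs_cont_on_interval a b g" and "C > 0"
    and le: "\<And>u v. \<lbrakk>u \<in> {a..b}; v \<in> {a..b}\<rbrakk> \<Longrightarrow>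
      dist (h u) (h v) \<le> C * (dist (f u) (f v) + dist (g u) (g v))"
  shows "abs_cont_on_interval a b h"
  unfolding abs_cont_on_interval_def
proof (intro allI impI)
  fix \<epsilon> :: real assume "\<epsilon> > 0"
  then have e: "\<epsilon> / (2 * C) > 0" using \<open>C > 0\<close> by simp
  obtain d1 where d1: "d1 > 0" "\<And>D :: (real \<times> real) set.
        \<lbrakk>finite D; \<forall>(u, v)\<in>D. a \<le> u \<and> u \<le> v \<and> v \<le> b;
        pairwise (\<lambda>(u, v) (u', v'). disjnt {u<..<v} {u'<..<v'}) D; (\<Sum>(u, v)\<in>D. v - u) < d1\<rbrakk> \<Longrightarrow>
        (\<Sum>(u, v)\<in>D. dist (f u) (f v)) < \<epsilon> / (2 * C)"
    using f e unfolding abs_cont_on_interval_def by meson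
  obtain d2 where d2: "d2 > 0" "\<And>D :: (real \<times> real) set.
        \<lbrakk>finite D; \<forall>(u, v)\<in>D. a \<le> u \<and> u \<le> v \<and> v \<le> b;
        pairwise (\<lambda>(u, v) (u', v'). disjnt {u<..<v} {u'<..<v'}) D; (\<Sum>(u, v)\<in>D. v - u) < d2\<rbrakk> \<Longrightarrow>
        (\<Sum>(u, v)\<in>D. dist (g u) (g v)) < \<epsilon> / (2 * C)"
    using g e unfolding abs_cont_on_interval_def by meson
  show "\<exists>\<delta>>0. \<forall>D. finite D \<longrightarrow> (\<forall>(u, v)\<in>D. a \<le> u \<and> u \<le> v \<and> v \<le> b) \<longrightarrow>
      pairwise (\<lambda>(u, v) (u', v'). disjnt {u<..<v} {u'<..<v'}) D \<longrightarrow>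
      (\<Sum>(u, v)\<in>D. v - u) < \<delta> \<longrightarrow> (\<Sum>(u, v)\<in>D. dist (h u) (h v)) < \<epsilon>"
  proof (intro exI[of _ "min d1 d2"] conjI allI impI)
    fix D :: "(real \<times> real) set"
    assume D: "finite D" "\<forall>(u, v)\<in>D. a \<le> u \<and> u \<le> v \<and> v \<le> b"
      "pairwise (\<lambda>(u, v) (u', v'). disjnt {u<..<v} {u'<..<v'}) D" "(\<Sum>(u, v)\<in>D. v - u) < min d1 d2"
    have "(\<Sum>(u, v)\<in>D. dist (h u) (h v)) \<le> (\<Sum>(u, v)\<in>D. C * (dist (f u) (f v) + dist (g u) (g v)))"
    proof (rule sum_mono, clarify)
      fix u v assume "(u, v) \<in> D"
      then show "dist (h u) (h v) \<le> C * (dist (f u) (f v) + dist (g u) (g v))"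
        using D(2) by (intro le) auto
    qed
    also have "\<dots> = C * ((\<Sum>(u, v)\<in>D. dist (f u) (f v)) + (\<Sum>(u, v)\<in>D. dist (g u) (g v)))"
      by (simp add: split_def sum.distrib flip: sum_distrib_left)
    also have "\<dots> < C * (\<epsilon> / (2 * C) + \<epsilon> / (2 * C))"
      using D \<open>C > 0\<close> by (intro mult_strict_left_mono add_strict_mono d1 d2) auto
    also have "\<dots> = \<epsilon>" using \<open>C > 0\<close> by (simp add: field_simps)
    finally show "(\<Sum>(u, v)\<in>D. dist (h u) (h v)) < \<epsilon>" .
  qed (use d1 d2 in auto)
qed

lemma abs_cont_on_interval_diff:
  fixes f g :: "real \<Rightarrow> 'a::real_normed_vector"
  assumes "abs_cont_on_interval a b f" "abs_cont_on_interval a b g"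
  shows "abs_cont_on_interval a b (\<lambda>t. f t - g t)"
proof (rule abs_cont_on_interval_if_dist_le_add[OF assms, of 1])
  fix u v
  have "f u - g u - (f v - g v) = (f u - f v) - (g u - g v)" by simp
  then show "dist (f u - g u) (f v - g v) \<le> 1 * (dist (f u) (f v) + dist (g u) (g v))"
    using norm_triangle_ineq4[of "f u - f v" "g u - g v"] unfolding dist_norm mult_1 by presburger
qed simp

lemma (in bounded_bilinear) abs_cont_on_interval:
  assumes f: "abs_cont_on_interval a b f" and g: "abs_cont_on_interval a b g"
  shows "abs_cont_on_interval a b (\<lambda>t. prod (f t) (g t))"
proof -
  obtain K where K: "K > 0" "\<And>x y. norm (prod x y) \<le> norm x * norm y * K"
    using pos_bounded by blast
  have "bounded (f ` {a..b})" "bounded (g ` {a..b})"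
    using f g by (auto intro!: compact_imp_bounded compact_continuous_image abs_cont_on_interval_imp_continuous_on)
  then obtain A B where A: "A > 0" "\<And>t. t \<in> {a..b} \<Longrightarrow> norm (f t) \<le> A"
    and B: "B > 0" "\<And>t. t \<in> {a..b} \<Longrightarrow> norm (g t) \<le> B"
    unfolding bounded_pos by auto
  show ?thesis
  proof (rule abs_cont_on_interval_if_dist_le_add[OF f g])
    show "(A + B) * K > 0" using A B K by simp
    fix u v assume uv: "u \<in> {a..b}" "v \<in> {a..b}"
    have "dist (prod (f u) (g u)) (prod (f v) (g v)) = norm (prod (f u - f v) (g u) + prod (f v) (g u - g v))"
      by (simp add: dist_norm diff_left diff_right)
    also have "\<dots> \<le> norm (f u - f v) * norm (g u) * K + norm (f v) * norm (g u - g v) * K"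
      by (intro norm_triangle_le add_mono K)
    also have "\<dots> \<le> norm (f u - f v) * (A + B) * K + (A + B) * norm (g u - g v) * K"
      using A(1) B(1) K(1) A(2)[OF uv(2)] B(2)[OF uv(1)] by (intro add_mono mult_mono) auto
    also have "\<dots> = (A + B) * K * (dist (f u) (f v) + dist (g u) (g v))"
      by (simp add: dist_norm algebra_simps)
    finally show "dist (prod (f u) (g u)) (prod (f v) (g v)) \<le> (A + B) * K * (dist (f u) (f v) + dist (g u) (g v))" .
  qed
qed

text \<open>Off \<open>N\<close> the gauge is the usual one from differentiability; at tags in \<open>N\<close> it is an open
  superset of \<open>N\<close> of small measure, so that absolute continuity controls those increments.\<close>

theorem fundamental_theorem_of_calculus_abs_cont:
  fixes f :: "real \<Rightarrow> 'a::banach"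
  assumes "a \<le> b" and ac: "abs_cont_on_interval a b f" and N: "negligible N"
    and der: "\<And>x. x \<in> {a..b} - N \<Longrightarrow> (f has_vector_derivative f' x) (at x within {a..b})"
  shows "(f' has_integral (f b - f a)) {a..b}"
proof -
  define g where "g x = (if x \<in> N then 0 else f' x)" for x
  have "(g has_integral (f b - f a)) {a..b}"
    unfolding has_integral_real
  proof (intro allI impI)
    fix e :: real
    assume "e > 0"
    define e1 where "e1 = e / (2 * (b - a + 1))"
    have "e1 > 0" using \<open>e > 0\<close> \<open>a \<le> b\<close> by (simp add: e1_def)
    have e1: "e1 * (b - a) < e / 2"
      using \<open>e > 0\<close> \<open>a \<le> b\<close> by (simp add: e1_def divide_simps)
    have "\<forall>x. \<exists>d>0. x \<in> {a..b} - N \<longrightarrow>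
         (\<forall>y\<in>{a..b}. norm (y-x) < d \<longrightarrow> norm (f y - f x - (y-x) *\<^sub>R f' x) \<le> e1 * norm (y-x))"
      using der[unfolded has_vector_derivative_def has_derivative_within_alt] \<open>e1 > 0\<close>
      by (meson zero_less_one)
    then obtain d where d0: "\<And>x. 0 < d x"
      and d: "\<And>x y. \<lbrakk>x \<in> {a..b} - N; y \<in> {a..b}; norm (y-x) < d x\<rbrakk>
                        \<Longrightarrow> norm (f y - f x - (y-x) *\<^sub>R f' x) \<le> e1 * norm (y-x)"
      by metis
    obtain \<delta> where "\<delta> > 0" and \<delta>: "\<And>D :: (real \<times> real) set.
        \<lbrakk>finite D; \<forall>(u, v)\<in>D. a \<le> u \<and> u \<le> v \<and> v \<le> b;
        pairwise (\<lambda>(u, v) (u', v'). disjnt {u<..<v} {u'<..<v'}) D; (\<Sum>(u, v)\<in>D. v - u) < \<delta>\<rbrakk> \<Longrightarrow>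
        (\<Sum>(u, v)\<in>D. dist (f u) (f v)) < e / 2"
      using ac half_gt_zero[OF \<open>e > 0\<close>] unfolding abs_cont_on_interval_def by meson
    have Nl: "N \<in> sets lebesgue" using N negligible_imp_sets by blast
    obtain T where T: "open T" "N \<subseteq> T" "T - N \<in> lmeasurable" "emeasure lebesgue (T - N) < ennreal \<delta>"
      using sets_lebesgue_outer_open[OF Nl \<open>\<delta> > 0\<close>] by blast
    have TT: "T = (T - N) \<union> N" using T by blast
    have Tm: "T \<in> lmeasurable"
      using T(3) N negligible_imp_measurable fmeasurable.Un TT by metis
    have Tme: "measure lebesgue T < \<delta>"
    proof -
      have "measure lebesgue T = measure lebesgue (T - N)"
        using TT N T(3) by (metis fmeasurableD measure_Un_null_set negligible_iff_null_sets)
      with T(4) show ?thesis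
        using \<open>\<delta> > 0\<close> T(3) by (simp add: emeasure_eq_measure2 ennreal_less_iff)
    qed
    define \<gamma> where "\<gamma> x = (if x \<in> N then T else ball x (d x))" for x
    have gauge: "gauge \<gamma>"
      using T d0 by (auto simp: gauge_def \<gamma>_def)
    have bound: "norm ((\<Sum>(x, K)\<in>p. measure lborel K *\<^sub>R g x) - (f b - f a)) < e"
      if p: "p tagged_division_of {a..b}" and fine: "\<gamma> fine p" for p
    proof -
      note pD = tagged_division_ofD[OF p]
      have K: "a \<le> Inf K \<and> Inf K \<le> x \<and> x \<le> Sup K \<and> Sup K \<le> b \<and> K = {Inf K..Sup K}"
        if xK: "(x, K) \<in> p" for x K
      proof -
        obtain u v where uv: "K = {u..v}" using pD(4)[OF xK] by auto
        then show ?thesis using pD(2,3)[OF xK] by auto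
      qed
      define q where "q = {xK \<in> p. fst xK \<in> N}"
      define J where "J = (\<lambda>(x :: real, K :: real set). (Inf K, Sup K))"
      have qp: "q \<subseteq> p" and "finite q" using pD(1) by (auto simp: q_def)
      have disj: "disjnt {Inf K<..<Sup K} {Inf K'<..<Sup K'}"
        if "(x, K) \<in> p" "(x', K') \<in> p" "(x, K) \<noteq> (x', K')" for x K x' K'
      proof -
        have "interior K = {Inf K<..<Sup K}" "interior K' = {Inf K'<..<Sup K'}"
          using K that by (metis interior_atLeastAtMost_real)+
        then show ?thesis using pD(5)[OF that] by (simp add: disjnt_def)
      qed
      have inj: "inj_on J q"
      proof (rule inj_onI, clarify)
        fix x K x' K'
        assume *: "(x, K) \<in> q" "(x', K') \<in> q" "J (x, K) = J (x', K')"
        then have **: "(x, K) \<in> p" "(x', K') \<in> p" "Inf K = Inf K'" "Sup K = Sup K'"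
          using qp by (auto simp: J_def)
        then have KK: "K = K'" using K by metis
        moreover have "x = x'"
        proof (rule ccontr)
          assume "x \<noteq> x'"
          then have "{Inf K<..<Sup K} = {}"
            using disj[OF **(1,2)] KK by (auto simp: disjnt_def)
          then show False using K[OF **(1)] K[OF **(2)] KK \<open>x \<noteq> x'\<close> by force
        qed
        ultimately show "x = x' \<and> K = K'" by simp
      qed
      have Dpair: "pairwise (\<lambda>(u, v) (u', v'). disjnt {u<..<v} {u'<..<v'}) (J ` q)"
        unfolding pairwise_image
        using disj qp by (fastforce simp: pairwise_def J_def)
      have "(\<Sum>(u, v)\<in>J ` q. v - u) \<le> measure lebesgue T"
      proof (rule sum_length_disjoint_intervals_le[OF _ Dpair Tm])
        fix u v assume "(u, v) \<in> J ` q"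
        then obtain x K where xK: "(x, K) \<in> p" "x \<in> N" "u = Inf K" "v = Sup K"
          by (auto simp: J_def q_def)
        have "K \<subseteq> T" using fine xK by (force simp: fine_def \<gamma>_def)
        then show "u \<le> v \<and> {u<..<v} \<subseteq> T"
          using K[OF xK(1)] xK by (metis greaterThanLessThan_subseteq_atLeastAtMost_iff order_trans order_refl)
      qed (use \<open>finite q\<close> in simp)
      then have "(\<Sum>(u, v)\<in>J ` q. dist (f u) (f v)) < e / 2"
        using \<open>finite q\<close> Dpair Tme K qp by (intro \<delta>) (fastforce simp: J_def)+
      then have sq: "(\<Sum>(x, K)\<in>q. dist (f (Inf K)) (f (Sup K))) < e / 2"
        unfolding sum.reindex[OF inj] by (simp add: J_def split_def o_def)
      have ba: "b - a = (\<Sum>(x,K)\<in>p. Sup K - Inf K)" "f b - f a = (\<Sum>(x,K)\<in>p. f(Sup K) - f(Inf K))"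
        using additive_tagged_division_1[OF \<open>a \<le> b\<close> p, of "\<lambda>x. x"]
          additive_tagged_division_1[OF \<open>a \<le> b\<close> p, of f] by auto
      have good: "norm (measure lborel K *\<^sub>R g x - (f (Sup K) - f (Inf K))) \<le> e1 * (Sup K - Inf K)"
        if "(x, K) \<in> p" "x \<notin> N" for x K
      proof -
        define u v where "u = Inf K" and "v = Sup K"
        have k: "K = {u..v}" "a \<le> u" "u \<le> x" "x \<le> v" "v \<le> b"
          using K[OF that(1)] by (simp_all add: u_def v_def)
        have "K \<subseteq> ball x (d x)" using fine that by (force simp: fine_def \<gamma>_def)
        then have uv: "norm (u - x) < d x" "norm (v - x) < d x"
          using subsetD[of K "ball x (d x)" u] subsetD[of K "ball x (d x)" v] k
          by (auto simp: dist_real_def)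
        have "norm ((v - u) *\<^sub>R f' x - (f v - f u)) = norm (f u - f x - (u - x) *\<^sub>R f' x - (f v - f x - (v - x) *\<^sub>R f' x))"
          by (auto simp: algebra_simps)
        also have "\<dots> \<le> norm (f u - f x - (u - x) *\<^sub>R f' x) + norm (f v - f x - (v - x) *\<^sub>R f' x)"
          by (rule norm_triangle_ineq4)
        also have "\<dots> \<le> e1 * norm (u - x) + e1 * norm (v - x)"
          using k that(2) uv by (intro add_mono d) auto
        also have "\<dots> = e1 * (v - u)"
          using k by (auto simp: algebra_simps)
        finally show ?thesis
          using k that(2) by (simp add: g_def)
      qed
      have "norm ((\<Sum>(x, K)\<in>p. measure lborel K *\<^sub>R g x) - (f b - f a))
          \<le> (\<Sum>(x, K)\<in>p. norm (measure lborel K *\<^sub>R g x - (f (Sup K) - f (Inf K))))"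
        unfolding ba split_def sum_subtractf[symmetric] by (rule norm_sum)
      also have "\<dots> = (\<Sum>(x, K)\<in>p - q. norm (measure lborel K *\<^sub>R g x - (f (Sup K) - f (Inf K)))) +
         (\<Sum>(x, K)\<in>q. norm (measure lborel K *\<^sub>R g x - (f (Sup K) - f (Inf K))))"
        using qp pD(1) by (rule sum.subset_diff)
      also have "(\<Sum>(x, K)\<in>q. norm (measure lborel K *\<^sub>R g x - (f (Sup K) - f (Inf K))))
          = (\<Sum>(x, K)\<in>q. dist (f (Inf K)) (f (Sup K)))"
        by (rule sum.cong) (auto simp: q_def g_def dist_norm norm_minus_commute)
      also have "(\<Sum>(x, K)\<in>p - q. norm (measure lborel K *\<^sub>R g x - (f (Sup K) - f (Inf K))))
          \<le> (\<Sum>(x, K)\<in>p - q. e1 * (Sup K - Inf K))"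
        by (rule sum_mono) (use good in \<open>auto simp: q_def\<close>)
      also have "\<dots> \<le> (\<Sum>(x, K)\<in>p. e1 * (Sup K - Inf K))"
        using K \<open>e1 > 0\<close> pD(1) by (intro sum_mono2) fastforce+
      also have "\<dots> = e1 * (b - a)"
        by (simp add: ba sum_distrib_left split_def)
      finally show ?thesis using sq e1 by linarith
    qed
    show "\<exists>\<gamma>. gauge \<gamma> \<and> (\<forall>p. p tagged_division_of {a..b} \<and> \<gamma> fine p \<longrightarrow>
        norm ((\<Sum>(x, k)\<in>p. measure lborel k *\<^sub>R g x) - (f b - f a)) < e)"
      using gauge bound by (intro exI[of _ \<gamma>]) simp
  qed
  then show ?thesis
    by (rule has_integral_spike[OF N, rotated]) (simp add: g_def)
qed

text \<open>The points where the difference quotients to arbitrarily near points are off by more than \<open>\<eta>\<close> are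
  covered by small intervals; Henstock's lemma bounds the total length of any disjoint family of
  these, hence, by Vitali's covering lemma, the outer measure of the set.\<close>

theorem negligible_not_has_vector_derivative_integral:
  fixes f :: "real \<Rightarrow> 'a::euclidean_space"
  assumes f: "f integrable_on {a..b}"
  shows "negligible {x \<in> {a..b}.
    \<not> ((\<lambda>t. integral {a..t} f) has_vector_derivative f x) (at x within {a..b})}"
proof -
  define \<Phi> where "\<Phi> t = integral {a..t} f" for t
  define E where "E \<eta> = {x \<in> {a..b}. \<forall>d>0. \<exists>y\<in>{a..b}. \<bar>y - x\<bar> < d \<and>
      norm (\<Phi> y - \<Phi> x - (y - x) *\<^sub>R f x) > \<eta> * \<bar>y - x\<bar>}" for \<eta> :: real
  have E: "negligible (E \<eta>)" if "\<eta> > 0" for \<eta>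
    unfolding negligible_outer_le
  proof (intro allI impI)
    fix e :: real
    assume "e > 0"
    then have "e * \<eta> / 5 > 0" using \<open>\<eta> > 0\<close> by simp
    then obtain \<gamma> where "gauge \<gamma>" and \<gamma>: "\<And>p. \<lbrakk>p tagged_partial_division_of (cbox a b); \<gamma> fine p\<rbrakk> \<Longrightarrow>
             (\<Sum>(x, K)\<in>p. norm (measure lborel K *\<^sub>R f x - integral K f)) < e * \<eta> / 5"
      using Henstock_lemma[OF f[folded box_real(2)]] by blast
    have "\<exists>y. y \<in> {a..b} \<and> \<bar>y - x\<bar> < 1 \<and> closed_segment x y \<subseteq> \<gamma> x \<and>
        norm (\<Phi> y - \<Phi> x - (y - x) *\<^sub>R f x) > \<eta> * \<bar>y - x\<bar>" if x: "x \<in> E \<eta>" for x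
    proof -
      obtain d where d: "d > 0" "ball x d \<subseteq> \<gamma> x"
        using \<open>gauge \<gamma>\<close> unfolding gauge_def open_contains_ball by blast
      then obtain y where y: "y \<in> {a..b}" "\<bar>y - x\<bar> < min d 1"
         "norm (\<Phi> y - \<Phi> x - (y - x) *\<^sub>R f x) > \<eta> * \<bar>y - x\<bar>"
        using x[unfolded E_def, THEN CollectD, THEN conjunct2, rule_format, of "min d 1"] by auto
      have "closed_segment x y \<subseteq> ball x d"
        using y d by (intro closed_segment_subset) (auto simp: dist_real_def)
      then show ?thesis using y d by auto
    qed
    then obtain y where y: "\<And>x. x \<in> E \<eta> \<Longrightarrow> y x \<in> {a..b}" "\<And>x. x \<in> E \<eta> \<Longrightarrow> \<bar>y x - x\<bar> < 1"
        "\<And>x. x \<in> E \<eta> \<Longrightarrow> closed_segment x (y x) \<subseteq> \<gamma> x"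
        "\<And>x. x \<in> E \<eta> \<Longrightarrow> norm (\<Phi> (y x) - \<Phi> x - (y x - x) *\<^sub>R f x) > \<eta> * \<bar>y x - x\<bar>"
      by metis
    define m r where "m x = (x + y x) / 2" and "r x = \<bar>y x - x\<bar> / 2" for x
    have cball: "cball (m x) (r x) = {min x (y x)..max x (y x)}" for x
      by (auto simp: cball_eq_atLeastAtMost m_def r_def field_simps abs_if min_def max_def)
    have r0: "0 < r x" if "x \<in> E \<eta>" for x
      using y(4)[OF that] by (cases "y x = x") (auto simp: r_def)
    have sub: "E \<eta> \<subseteq> (\<Union>x\<in>E \<eta>. cball (m x) (r x))"
      by (auto simp: cball)
    obtain C where C: "countable C" "C \<subseteq> E \<eta>"
        "pairwise (\<lambda>i j. disjnt (cball (m i) (r i)) (cball (m j) (r j))) C"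
        "E \<eta> \<subseteq> (\<Union>i\<in>C. cball (m i) (5 * r i))"
      proof (rule Vitali_covering_lemma_cballs[OF sub])
      show "0 < r x \<and> r x \<le> 1" if "x \<in> E \<eta>" for x
        using y(2)[OF that] r0[OF that] by (simp add: r_def)
    qed blast
    have bound: "measure lebesgue (\<Union>i\<in>I. cball (m i) (5 * r i)) \<le> e" if I: "I \<subseteq> C" "finite I" for I
    proof -
      define p where "p = (\<lambda>x. (x, cball (m x) (r x))) ` I"
      have IE: "x \<in> E \<eta>" if "x \<in> I" for x using that I C by blast
      have ab: "x \<in> {a..b}" if "x \<in> I" for x using IE[OF that] by (simp add: E_def)
      have cab: "cball (m x) (r x) \<subseteq> {a..b}" if "x \<in> I" for x
        using y(1)[OF IE[OF that]] ab[OF that] by (auto simp: cball min_le_iff_disj le_max_iff_disj)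
      have "p tagged_partial_division_of cbox a b"
        unfolding tagged_partial_division_of_def
      proof (intro conjI allI impI)
        fix x1 K1 x2 K2
        assume *: "(x1, K1) \<in> p \<and> (x2, K2) \<in> p \<and> (x1, K1) \<noteq> (x2, K2)"
        then have "x1 \<in> C" "x2 \<in> C" "x1 \<noteq> x2" "K1 = cball (m x1) (r x1)" "K2 = cball (m x2) (r x2)"
          using I(1) by (auto simp: p_def)
        then have "disjnt K1 K2"
          using pairwiseD[OF C(3)] by simp
        then show "interior K1 \<inter> interior K2 = {}"
          by (meson disjnt_def disjoint_iff interior_subset subsetD)
      next
        fix x K assume "(x, K) \<in> p"
        then have "x \<in> I" "K = cball (m x) (r x)" by (auto simp: p_def)
        then show "x \<in> K" "K \<subseteq> cbox a b" "\<exists>a b. K = cbox a b"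
          using cab[of x] by (auto simp: cball simp flip: box_real(2))
      qed (use I in \<open>simp add: p_def\<close>)
      moreover have "\<gamma> fine p"
        using y(3) IE by (fastforce simp: fine_def p_def cball closed_segment_eq_real_ivl min_def max_def split: if_splits)
      ultimately have "(\<Sum>(x, K)\<in>p. norm (measure lborel K *\<^sub>R f x - integral K f)) < e * \<eta> / 5"
        by (rule \<gamma>)
      also have "(\<Sum>(x, K)\<in>p. norm (measure lborel K *\<^sub>R f x - integral K f))
         = (\<Sum>x\<in>I. norm (measure lborel (cball (m x) (r x)) *\<^sub>R f x - integral (cball (m x) (r x)) f))"
        unfolding p_def by (subst sum.reindex) (auto simp: inj_on_def)
      finally have 1: "(\<Sum>x\<in>I. norm (measure lborel (cball (m x) (r x)) *\<^sub>R f x - integral (cball (m x) (r x)) f)) < e * \<eta> / 5" .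
      have 2: "\<eta> * (2 * r x) \<le> norm (measure lborel (cball (m x) (r x)) *\<^sub>R f x - integral (cball (m x) (r x)) f)"
        if "x \<in> I" for x
      proof -
        note x = IE[OF that] ab[OF that] and yx = y(1)[OF IE[OF that]]
        have int: "integral {u..v} f = \<Phi> v - \<Phi> u" if "a \<le> u" "u \<le> v" "v \<le> b" for u v
        proof -
          have "f integrable_on {a..v}"
            using f that by (meson integrable_on_subinterval atLeastatMost_subset_iff order_refl)
          then show ?thesis unfolding \<Phi>_def
            using Henstock_Kurzweil_Integration.integral_combine[of a u v f] that by (simp add: algebra_simps)
        qed
        have "norm (\<Phi> (y x) - \<Phi> x - (y x - x) *\<^sub>R f x)
           = norm (measure lborel (cball (m x) (r x)) *\<^sub>R f x - integral (cball (m x) (r x)) f)"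
        proof (cases "x \<le> y x")
          case True
          then show ?thesis using x(2) yx int[of x "y x"]
            by (simp add: cball norm_minus_commute)
        next
          case False
          then have "\<Phi> x = \<Phi> (y x) + integral {y x..x} f"
            using x(2) yx int[of "y x" x] by simp
          then show ?thesis using False
            by (simp add: cball algebra_simps)
        qed
        then show ?thesis using y(4)[OF x(1)] by (simp add: r_def)
      qed
      have 3: "(\<Sum>i\<in>I. \<eta> * (2 * r i)) \<le> e * \<eta> / 5"
        using 1 sum_mono[of I "\<lambda>i. \<eta> * (2 * r i)", OF 2] by simp
      have "measure lebesgue (\<Union>i\<in>I. cball (m i) (5 * r i)) \<le> (\<Sum>i\<in>I. measure lebesgue (cball (m i) (5 * r i)))"
        using I by (intro measure_UNION_le) auto
      also have "\<dots> = (\<Sum>i\<in>I. 10 * r i)"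
        using IE r0 by (intro sum.cong) (auto simp: cball_eq_atLeastAtMost less_imp_le)
      also have "\<dots> = 5 / \<eta> * (\<Sum>i\<in>I. \<eta> * (2 * r i))"
        using \<open>\<eta> > 0\<close> by (simp add: sum_distrib_left)
      also have "\<dots> \<le> 5 / \<eta> * (e * \<eta> / 5)"
        using 3 \<open>\<eta> > 0\<close> by (intro mult_left_mono) auto
      also have "\<dots> = e" using \<open>\<eta> > 0\<close> by simp
      finally show ?thesis .
    qed
    show "\<exists>T. E \<eta> \<subseteq> T \<and> T \<in> lmeasurable \<and> measure lebesgue T \<le> e"
      using C(4) fmeasurable_UN_bound[OF C(1) lmeasurable_cball bound]
        measure_UN_bound[OF C(1) lmeasurable_cball bound] by blast
  qed
  have "{x \<in> {a..b}. \<not> (\<Phi> has_vector_derivative f x) (at x within {a..b})} \<subseteq> (\<Union>n. E (1 / real (Suc n)))"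
  proof
    fix x assume "x \<in> {x \<in> {a..b}. \<not> (\<Phi> has_vector_derivative f x) (at x within {a..b})}"
    then have x: "x \<in> {a..b}" and nd: "\<not> (\<Phi> has_vector_derivative f x) (at x within {a..b})" by auto
    obtain e where e: "e > 0" "\<And>d. d > 0 \<Longrightarrow> \<exists>y\<in>{a..b}. \<bar>y - x\<bar> < d \<and>
       norm (\<Phi> y - \<Phi> x - (y - x) *\<^sub>R f x) > e * \<bar>y - x\<bar>"
      using nd unfolding has_vector_derivative_def has_derivative_within_alt
      by (auto simp: bounded_linear_scaleR_left not_le)
    obtain n where n: "inverse (real (Suc n)) < e" using reals_Archimedean e(1) by blast
    have "x \<in> E (1 / real (Suc n))"
      unfolding E_def
    proof (intro CollectI conjI x allI impI)
      fix d :: real assume "d > 0"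
      then obtain y where y: "y\<in>{a..b}" "\<bar>y - x\<bar> < d" "norm (\<Phi> y - \<Phi> x - (y - x) *\<^sub>R f x) > e * \<bar>y - x\<bar>"
        using e(2) by blast
      moreover have "1 / real (Suc n) * \<bar>y - x\<bar> \<le> e * \<bar>y - x\<bar>"
        using n by (intro mult_right_mono) (auto simp: inverse_eq_divide)
      ultimately show "\<exists>y\<in>{a..b}. \<bar>y - x\<bar> < d \<and> 1 / real (Suc n) * \<bar>y - x\<bar> < norm (\<Phi> y - \<Phi> x - (y - x) *\<^sub>R f x)"
        by (intro bexI[of _ y]) auto
    qed
    then show "x \<in> (\<Union>n. E (1 / real (Suc n)))" by blast
  qed
  moreover have "negligible (\<Union>n. E (1 / real (Suc n)))"
    using E by (intro negligible_countable_Union) auto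
  ultimately show ?thesis
    unfolding \<Phi>_def by (rule negligible_subset[rotated])
qed

lemma abs_cont_on_interval_antimono:
  fixes f :: "real \<Rightarrow> real"
  assumes "a \<le> b" and ac: "abs_cont_on_interval a b f" and N: "negligible N"
    and der: "\<And>x. x \<in> {a..b} - N \<Longrightarrow> \<exists>D\<le>0. (f has_vector_derivative D) (at x within {a..b})"
  shows "f b \<le> f a"
proof -
  obtain D where D: "\<And>x. x \<in> {a..b} - N \<Longrightarrow> D x \<le> 0 \<and> (f has_vector_derivative D x) (at x within {a..b})"
    using der by metis
  define D0 where "D0 x = (if x \<in> N then 0 else D x)" for x
  have int: "(D0 has_integral f b - f a) {a..b}"
    using D by (intro fundamental_theorem_of_calculus_abs_cont[OF assms(1,2) N]) (auto simp: D0_def)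
  have "f b - f a \<le> 0"
    by (rule has_integral_le[OF int has_integral_0]) (use D in \<open>auto simp: D0_def\<close>)
  then show ?thesis by simp
qed

lemma abs_cont_on_interval_if_less:
  assumes "b < a"
  shows "abs_cont_on_interval a b f"
proof -
  have "(\<Sum>(u, v)\<in>D. dist (f u) (f v)) = 0" if "\<forall>(u, v)\<in>D. a \<le> u \<and> u \<le> v \<and> v \<le> b"
    for D :: "(real \<times> real) set"
    using that assms by (intro sum.neutral) force
  then show ?thesis
    unfolding abs_cont_on_interval_def by (intro allI impI exI[of _ 1]) simp
qed

context
  fixes K :: "real \<Rightarrow> real"
  assumes K: "locally_integrable_halfline K" and K_nonneg: "\<And>t. t \<ge> 0 \<Longrightarrow> K t \<ge> 0"
begin

lemma set_integrable_interval:
  assumes "0 \<le> a"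
  shows "set_integrable lebesgue {a..b} K"
proof (rule set_integrable_subset)
  show "set_integrable lebesgue {0..max 0 b} K"
    using K by (simp add: locally_integrable_halfline_def)
qed (use assms in auto)

lemma integrable_interval: "0 \<le> a \<Longrightarrow> K integrable_on {a..b}"
  using set_lebesgue_integral_eq_integral(1)[OF set_integrable_interval] .

lemma integral_diff_interval:
  assumes "0 \<le> u" "u \<le> v"
  shows "integral {0..v} K - integral {0..u} K = integral {u..v} K"
  using Henstock_Kurzweil_Integration.integral_combine[OF assms integrable_interval] by simp

lemma integral_interval_nonneg: "0 \<le> u \<Longrightarrow> 0 \<le> integral {u..v} K"
  using K_nonneg by (intro integral_nonneg integrable_interval) auto

lemma integral_interval_mono:
  assumes "0 \<le> u" "u \<le> v"
  shows "integral {0..u} K \<le> integral {0..v} K"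
  using integral_diff_interval[OF assms] integral_interval_nonneg[OF assms(1), of v] by simp

lemma AE_has_vector_derivative_integral:
  "AE t in lebesgue. t \<ge> 0 \<longrightarrow>
    ((\<lambda>t. integral {0..t} K) has_vector_derivative K t) (at t within {0..})"
proof -
  define B where "B n = {t \<in> {0..real n}. \<not> ((\<lambda>t. integral {0..t} K) has_vector_derivative K t)
    (at t within {0..real n})}" for n
  have "negligible (\<Union>n. B n)"
    unfolding B_def
    by (rule negligible_countable_Union)
      (auto intro: negligible_not_has_vector_derivative_integral[OF integrable_interval] simp del: atLeastAtMost_iff)
  then have "AE t in lebesgue. t \<notin> (\<Union>n. B n)"
    by (intro AE_not_in) (simp add: negligible_iff_null_sets)
  then show ?thesis
  proof eventually_elim
    case (elim t)
    show ?case
    proof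
      assume "t \<ge> 0"
      obtain n where n: "t < real n" using reals_Archimedean2 by blast
      have "at t within {0..real n} = at t within {0..}"
        by (rule at_within_nhd[of t "{..<real n}"]) (use n in auto)
      moreover have "((\<lambda>t. integral {0..t} K) has_vector_derivative K t) (at t within {0..real n})"
        using elim n \<open>t \<ge> 0\<close> by (auto simp: B_def)
      ultimately show "((\<lambda>t. integral {0..t} K) has_vector_derivative K t) (at t within {0..})"
        by simp
    qed
  qed
qed

lemma abs_cont_on_interval_if_dist_le_scaled_integral:
  fixes f :: "real \<Rightarrow> 'a::metric_space"
  assumes "0 \<le> a" "0 \<le> C"
    and le: "\<And>u v. \<lbrakk>a \<le> u; u \<le> v; v \<le> b\<rbrakk> \<Longrightarrow> dist (f u) (f v) \<le> C * (integral {0..v} K - integral {0..u} K)"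
  shows "abs_cont_on_interval a b f"
proof (rule abs_cont_on_interval_if_dist_le_integral)
  show "set_integrable lebesgue {a..b} (\<lambda>t. C * K t)"
    using set_integrable_interval[OF assms(1)] by simp
  show "0 \<le> C * K t" if "t \<in> {a..b}" for t
    using that K_nonneg assms by simp
  show "dist (f u) (f v) \<le> integral {u..v} (\<lambda>t. C * K t)" if "a \<le> u" "u \<le> v" "v \<le> b" for u v
    using le[OF that] integral_diff_interval[of u v] that assms(1) by simp
qed

lemma caratheodory_solution_flow:
  fixes F :: "'a::real_normed_vector \<Rightarrow> 'a"
  assumes F: "continuous_on UNIV F" and \<Phi>: "complete_flow_of F \<Phi>"
  shows "caratheodory_solution K F x (\<lambda>t. \<Phi> (integral {0..t} K) x)"
proof -
  have der: "((\<lambda>r. \<Phi> r x) has_vector_derivative F (\<Phi> s x)) (at s)" for s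
    using \<Phi> by (simp add: complete_flow_of_def)
  have cont: "continuous_on A (\<lambda>s. F (\<Phi> s x))" for A
  proof (rule continuous_on_compose2[OF F])
    show "continuous_on A (\<lambda>s. \<Phi> s x)"
      by (intro continuous_at_imp_continuous_on ballI has_vector_derivative_continuous[OF der])
  qed simp
  have "abs_cont_on_interval a b (\<lambda>t. \<Phi> (integral {0..t} K) x)" if ab: "{a..b} \<subseteq> {0..}" for a b
  proof (cases "a \<le> b")
    case True
    then have "0 \<le> a" using ab by auto
    define M where "M = integral {0..b} K"
    have "bounded ((\<lambda>s. F (\<Phi> s x)) ` {0..M})"
      by (intro compact_imp_bounded compact_continuous_image cont) auto
    then obtain C where C: "C > 0" "\<And>s. s \<in> {0..M} \<Longrightarrow> norm (F (\<Phi> s x)) \<le> C"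
      unfolding bounded_pos by auto
    have lip: "norm (\<Phi> s x - \<Phi> s' x) \<le> C * norm (s - s')" if "s \<in> {0..M}" "s' \<in> {0..M}" for s s'
    proof (rule differentiable_bound[OF convex_real_interval(5) _ _ that])
      show "((\<lambda>r. \<Phi> r x) has_derivative (\<lambda>h. h *\<^sub>R F (\<Phi> r x))) (at r within {0..M})" for r
        using der[of r] by (simp add: has_vector_derivative_def has_derivative_at_withinI)
      show "onorm (\<lambda>h. h *\<^sub>R F (\<Phi> r x)) \<le> C" if "r \<in> {0..M}" for r
        using C(2)[OF that] by (simp add: onorm_scaleR_left[OF bounded_linear_ident] onorm_id)
    qed
    show ?thesis
    proof (rule abs_cont_on_interval_if_dist_le_scaled_integral[OF \<open>0 \<le> a\<close>])
      show "0 \<le> C" using C by simp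
      fix u v assume uv: "a \<le> u" "u \<le> v" "v \<le> b"
      then have "integral {0..u} K \<in> {0..M}" "integral {0..v} K \<in> {0..M}"
        "integral {0..u} K \<le> integral {0..v} K"
        using \<open>0 \<le> a\<close> by (auto simp: M_def intro: integral_interval_nonneg integral_interval_mono)
      then show "dist (\<Phi> (integral {0..u} K) x) (\<Phi> (integral {0..v} K) x)
          \<le> C * (integral {0..v} K - integral {0..u} K)"
        using lip[of "integral {0..u} K" "integral {0..v} K"] by (simp add: dist_norm)
    qed
  qed (simp add: abs_cont_on_interval_if_less)
  moreover have "AE t in lebesgue. t \<ge> 0 \<longrightarrow> ((\<lambda>t. \<Phi> (integral {0..t} K) x)
      has_vector_derivative K t *\<^sub>R F (\<Phi> (integral {0..t} K) x)) (at t within {0..})"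
    using AE_has_vector_derivative_integral
  proof eventually_elim
    case (elim t)
    then show ?case
      using vector_diff_chain_within[of "\<lambda>t. integral {0..t} K" "K t" t "{0..}" "\<lambda>s. \<Phi> s x"]
        has_vector_derivative_at_within[OF der] by (auto simp: o_def)
  qed
  ultimately show ?thesis
    using \<Phi> by (simp add: caratheodory_solution_def locally_abs_cont_on_def complete_flow_of_def)
qed

text \<open>Gronwall's argument: \<open>\<bar>\<psi> - \<theta>\<bar>\<^sup>2 exp (-2 L S)\<close> with \<open>S t = \<integral>\<^sub>0\<^sup>t K\<close> is absolutely
  continuous and has a nonpositive derivative almost everywhere.\<close>

lemma caratheodory_solution_unique:
  fixes F :: "'a::euclidean_space \<Rightarrow> 'a"
  assumes F: "locally_lipschitz_field F"
    and \<theta>: "caratheodory_solution K F x \<theta>" and \<psi>: "caratheodory_solution K F x \<psi>"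
    and "T \<ge> 0"
  shows "\<psi> T = \<theta> T"
proof -
  define S where "S t = integral {0..t} K" for t
  have ac: "abs_cont_on_interval 0 T \<theta>" "abs_cont_on_interval 0 T \<psi>"
    using \<theta> \<psi> by (auto simp: caratheodory_solution_def locally_abs_cont_on_def)
  then have "bounded (\<theta> ` {0..T} \<union> \<psi> ` {0..T})"
    by (auto intro!: compact_imp_bounded compact_continuous_image abs_cont_on_interval_imp_continuous_on)
  then obtain R where R: "\<And>t. t \<in> {0..T} \<Longrightarrow> \<theta> t \<in> cball 0 R \<and> \<psi> t \<in> cball 0 R"
    unfolding bounded_iff by (metis UnI1 UnI2 imageI mem_cball_0)
  have "local_lipschitz {0::real} (cball 0 R) (\<lambda>_. F)"
    using F unfolding locally_lipschitz_field_def by (rule local_lipschitz_subset) auto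
  then obtain L where "L-lipschitz_on (cball 0 R) F"
    using local_lipschitz_compact_implies_lipschitz[of "{0::real}" "cball 0 R" "\<lambda>_. F"] by fastforce
  then have L: "L \<ge> 0" "\<And>t. t \<in> {0..T} \<Longrightarrow> norm (F (\<psi> t) - F (\<theta> t)) \<le> L * norm (\<psi> t - \<theta> t)"
    using R by (auto dest: lipschitz_on_nonneg intro!: lipschitz_on_normD simp del: mem_cball)
  define w where "w t = \<psi> t - \<theta> t" for t
  define \<phi> where "\<phi> t = (w t \<bullet> w t) * exp (- 2 * L * S t)" for t
  have "abs_cont_on_interval 0 T (\<lambda>t. exp (- 2 * L * S t))"
  proof (rule abs_cont_on_interval_if_dist_le_scaled_integral)
    show "0 \<le> 2 * L" using L by simp
    fix u v assume uv: "0 \<le> u" "u \<le> v" "v \<le> T"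
    have S: "0 \<le> S u" "S u \<le> S v"
      using uv by (auto simp: S_def intro: integral_interval_nonneg integral_interval_mono)
    define d where "d = 2 * L * (S v - S u)"
    have "d \<ge> 0" using L S by (simp add: d_def)
    have "exp (- 2 * L * S v) = exp (- 2 * L * S u) * exp (- d)"
      by (simp add: d_def algebra_simps flip: exp_add)
    then have "exp (- 2 * L * S u) - exp (- 2 * L * S v) = exp (- 2 * L * S u) * (1 - exp (- d))"
      by (simp only: right_diff_distrib mult_1_right)
    then have "dist (exp (- 2 * L * S u)) (exp (- 2 * L * S v)) = exp (- 2 * L * S u) * \<bar>1 - exp (- d)\<bar>"
      by (simp only: dist_real_def abs_mult abs_exp_cancel)
    also have "\<dots> \<le> 1 * d"
      using exp_ge_add_one_self[of "- d"] \<open>d \<ge> 0\<close> L S by (intro mult_mono) auto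
    finally show "dist (exp (- 2 * L * S u)) (exp (- 2 * L * S v))
        \<le> 2 * L * (integral {0..v} K - integral {0..u} K)"
      by (simp add: d_def S_def)
  qed simp
  then have ac_\<phi>: "abs_cont_on_interval 0 T \<phi>"
    unfolding \<phi>_def w_def
    by (intro bounded_bilinear.abs_cont_on_interval[OF bounded_bilinear_mult]
        bounded_bilinear.abs_cont_on_interval[OF bounded_bilinear_inner] abs_cont_on_interval_diff ac)
  have "AE t in lebesgue. t \<in> {0..T} \<longrightarrow> (\<exists>D\<le>0. (\<phi> has_vector_derivative D) (at t within {0..T}))"
    using AE_has_vector_derivative_integral \<theta>[unfolded caratheodory_solution_def, THEN conjunct2, THEN conjunct2]
      \<psi>[unfolded caratheodory_solution_def, THEN conjunct2, THEN conjunct2]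
  proof eventually_elim
    case (elim t)
    show ?case
    proof
      assume t: "t \<in> {0..T}"
      let ?w' = "K t *\<^sub>R (F (\<psi> t) - F (\<theta> t))" and ?E = "exp (- 2 * L * S t)"
      have within: "(f has_vector_derivative D) (at t within {0..T})"
        if "(f has_vector_derivative D) (at t within {0..})" for f :: "real \<Rightarrow> 'b::real_normed_vector" and D
        using that by (rule has_vector_derivative_within_subset) auto
      have "(S has_vector_derivative K t) (at t within {0..T})"
        unfolding S_def using elim t by (intro within) auto
      then have "(S has_real_derivative K t) (at t within {0..T})"
        by (simp add: has_real_derivative_iff_has_vector_derivative)
      then have E': "((\<lambda>t. exp (- 2 * L * S t)) has_vector_derivative ?E * (- 2 * L * K t)) (at t within {0..T})"
        unfolding has_real_derivative_iff_has_vector_derivative[symmetric]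
        by (auto intro!: derivative_eq_intros)
      have w': "(w has_vector_derivative ?w') (at t within {0..T})"
        unfolding w_def scaleR_diff_right using elim t by (intro has_vector_derivative_diff within) auto
      have "(\<phi> has_vector_derivative (w t \<bullet> w t) * (?E * (- 2 * L * K t)) + (w t \<bullet> ?w' + ?w' \<bullet> w t) * ?E)
          (at t within {0..T})"
        unfolding \<phi>_def
        by (intro bounded_bilinear.has_vector_derivative[OF bounded_bilinear_mult]
            bounded_bilinear.has_vector_derivative[OF bounded_bilinear_inner] w' E')
      moreover have "w t \<bullet> (F (\<psi> t) - F (\<theta> t)) \<le> L * (w t \<bullet> w t)"
      proof -
        have "w t \<bullet> (F (\<psi> t) - F (\<theta> t)) \<le> norm (w t) * norm (F (\<psi> t) - F (\<theta> t))"
          by (rule norm_cauchy_schwarz)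
        also have "\<dots> \<le> norm (w t) * (L * norm (w t))"
          using L(2)[OF t] by (intro mult_left_mono) (auto simp: w_def)
        finally show ?thesis by (simp add: dot_square_norm power2_eq_square algebra_simps)
      qed
      then have "2 * K t * ?E * (w t \<bullet> (F (\<psi> t) - F (\<theta> t)) - L * (w t \<bullet> w t)) \<le> 0"
        using K_nonneg[of t] t by (intro mult_nonneg_nonpos) auto
      then have "(w t \<bullet> w t) * (?E * (- 2 * L * K t)) + (w t \<bullet> ?w' + ?w' \<bullet> w t) * ?E \<le> 0"
        by (simp add: algebra_simps inner_commute)
      ultimately show "\<exists>D\<le>0. (\<phi> has_vector_derivative D) (at t within {0..T})" by blast
    qed
  qed
  then obtain N where N: "N \<in> null_sets lebesgue"
    "{t \<in> space lebesgue. \<not> (t \<in> {0..T} \<longrightarrow> (\<exists>D\<le>0. (\<phi> has_vector_derivative D) (at t within {0..T})))} \<subseteq> N"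
    unfolding eventually_ae_filter by blast
  have "\<phi> T \<le> \<phi> 0"
    using \<open>T \<ge> 0\<close> ac_\<phi>
    by (rule abs_cont_on_interval_antimono[where N = N]) (use N in \<open>auto simp: negligible_iff_null_sets\<close>)
  also have "\<phi> 0 = 0"
    using \<theta> \<psi> by (simp add: \<phi>_def w_def caratheodory_solution_def)
  finally show ?thesis
    by (simp add: \<phi>_def w_def mult_le_0_iff dot_square_norm)
qed

lemma integral_tendsto_total_integral:
  assumes "total_integral K < \<infinity>"
  shows "((\<lambda>t. integral {0..t} K) \<longlongrightarrow> enn2real (total_integral K)) at_top"
proof -
  let ?k = "\<lambda>t. indicat_real {0..} t *\<^sub>R K t"
  have nn: "total_integral K = (\<integral>\<^sup>+ t. ennreal (?k t) \<partial>lebesgue)"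
    unfolding total_integral_def by (intro nn_integral_cong) (auto simp: indicator_def)
  have k0: "0 \<le> ?k t" for t using K_nonneg by (simp add: indicator_def)
  have meas: "?k \<in> borel_measurable lebesgue"
  proof (rule borel_measurable_LIMSEQ_real)
    show "(\<lambda>t. indicat_real {0..real n} t *\<^sub>R K t) \<in> borel_measurable lebesgue" for n
      using set_integrable_interval[of 0 "real n"] by (simp add: set_integrable_def)
    show "(\<lambda>n. indicat_real {0..real n} t *\<^sub>R K t) \<longlonglongrightarrow> ?k t" for t
    proof (rule tendsto_eventually)
      obtain N where "t \<le> real N" using real_arch_simple by blast
      then show "\<forall>\<^sub>F n in sequentially. indicat_real {0..real n} t *\<^sub>R K t = ?k t"
        by (intro eventually_sequentiallyI[of N]) (auto simp: indicator_def)
    qed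
  qed
  have int: "set_integrable lebesgue {0..} K"
    unfolding set_integrable_def
    using meas k0 assms by (intro integrableI_nonneg) (auto simp: nn)
  have "(LINT t:{0..}|lebesgue. K t) = enn2real (total_integral K)"
    unfolding set_lebesgue_integral_def nn using meas k0 by (intro integral_eq_nn_integral) auto
  moreover have "(LINT t:{0..b}|lebesgue. K t) = integral {0..b} K" for b
    by (intro set_lebesgue_integral_eq_integral set_integrable_interval) simp
  ultimately show ?thesis
    using tendsto_set_lebesgue_integral_at_top[OF _ int] by simp
qed

end

theorem corollary1:
  fixes F :: "real ^ 'n \<Rightarrow> real ^ 'n"
    and \<Phi> :: "real \<Rightarrow> real ^ 'n \<Rightarrow> real ^ 'n"
    and K :: "real \<Rightarrow> real"
    and \<theta>\<^sub>0 :: "real ^ 'n"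
  assumes "torus_vector_field F"
    and "locally_lipschitz_field F"
    and "complete_flow_of F \<Phi>"
    and "locally_integrable_halfline K"
    and "\<And>t. t \<ge> 0 \<Longrightarrow> K t \<ge> 0"
    and "total_integral K < \<infinity>"
  shows "\<exists>\<theta>. caratheodory_solution K F \<theta>\<^sub>0 \<theta> \<and>
             (\<forall>\<psi>. caratheodory_solution K F \<theta>\<^sub>0 \<psi> \<longrightarrow> (\<forall>t\<ge>0. \<psi> t = \<theta> t)) \<and>
             (\<theta> \<longlongrightarrow> \<Phi> (enn2real (total_integral K)) \<theta>\<^sub>0) at_top"
proof (intro exI conjI allI impI)
  let ?\<theta> = "\<lambda>t. \<Phi> (integral {0..t} K) \<theta>\<^sub>0"
  have "continuous_on UNIV F"
    using assms(2) unfolding locally_lipschitz_field_def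
    by (rule local_lipschitz_continuous_on[of UNIV UNIV "\<lambda>_. F" 0]) simp
  then show sol: "caratheodory_solution K F \<theta>\<^sub>0 ?\<theta>"
    by (intro caratheodory_solution_flow assms) auto
  show "\<psi> t = ?\<theta> t" if "caratheodory_solution K F \<theta>\<^sub>0 \<psi>" "t \<ge> 0" for \<psi> t
    using assms(4,5,2) sol that by (rule caratheodory_solution_unique)
  have "((\<lambda>s. \<Phi> s \<theta>\<^sub>0) has_vector_derivative F (\<Phi> s \<theta>\<^sub>0)) (at s)" for s
    using assms(3) by (simp add: complete_flow_of_def)
  then have "isCont (\<lambda>s. \<Phi> s \<theta>\<^sub>0) s" for s
    by (rule has_vector_derivative_continuous)
  then show "(?\<theta> \<longlongrightarrow> \<Phi> (enn2real (total_integral K)) \<theta>\<^sub>0) at_top"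
    by (rule isCont_tendsto_compose) (use assms in \<open>intro integral_tendsto_total_integral\<close>)
qed

end
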